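(* Let $(\mathbb{X},d)$ be a complete metric space and let $\mathcal{F}$ be an iterated function system on $\mathbb{X}$ with attractor $A$ and basin of attraction $U$. If $\mathcal{F}:\mathbb{H}(U)\to\mathbb{H}(U)$ is continuous (with respect to the Hausdorff metric), then $$A=\bigcap_{K\ge1}\overline{\bigcup_{k\ge K}\mathcal{F}^{k}(B)}$$ for all $B\subset U$ such that $\overline{B}\in\mathbb{H}(U)$.
   Context: An iterated function system (IFS) $\mathcal{F}=(\mathbb{X};f_1,\dots,f_M)$ on a complete metric space $(\mathbb{X},d)$ consists of finitely many continuous maps $f_m:\mathbb{X}\to\mathbb{X}$, $m=1,\dots,M$ (no contractivity is assumed). The same symbol denotes the map on subsets $\mathcal{F}(B)=\bigcup_{m=1}^M f_m(B)$ for $B\subset\mathbb{X}$; $\mathcal{F}^k$ is its $k$-fold composition, with $\mathcal{F}^0(B)=B$. $\overline{S}$ denotes the closure of $S$ in $\mathbb{X}$. $\mathbb{H}=\mathbb{H}(\mathbb{X})$ is the set of nonempty compact subsets of $\mathbb{X}$, and for nonempty $U\subset\mathbb{X}$, $\mathbb{H}(U)$ is the set of nonempty compact subsets of $\mathbb{X}$ contained in $U$. For $S\subset\mathbb{X}$ and $r>0$ let $S+r=\{y\in\mathbb{X}: d(x,y)<r\text{ for some }x\in S\}$. The Hausdorff metric on $\mathbb{H}$ is $d_{\mathbb{H}}(B,C)=\inf\{r>0: B\subset C+r\text{ and }C\subset B+r\}$. Attractor and basin: a nonempty compact set $A\subset\mathbb{X}$ is an attractor of $\mathcal{F}$ if (i)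 $\mathcal{F}(A)=A$, and (ii) there is an open set $U\subset\mathbb{X}$ with $A\subset U$ and $\lim_{k\to\infty}\mathcal{F}^k(B)=A$ in the Hausdorff metric for all $B\in\mathbb{H}(U)$. The largest open set $U$ for which (ii) holds is called the basin of attraction of $A$. *)

theory Defs
  imports "HOL-Analysis.Analysis"
begin

definition compacts_in :: "'a::metric_space set \<Rightarrow> 'a set set" where
  "compacts_in U = {B. B \<noteq> {} \<and> compact B \<and> B \<subseteq> U}"

definition thicken :: "'a::metric_space set \<Rightarrow> real \<Rightarrow> 'a set" where
  "thicken S r = {y. \<exists>x\<in>S. dist x y < r}"

text \<open>The infimum is only meaningful on nonempty compact sets, where it ranges over a nonempty
  set of radii. Elsewhere the distance is set to 0, because \<^locale>\<open>Metric_space\<close> demands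
  symmetry and nonnegativity on the whole type.\<close>

definition hausdorff_dist :: "'a::metric_space set \<Rightarrow> 'a set \<Rightarrow> real" where
  "hausdorff_dist B C =
     (if B \<in> compacts_in UNIV \<and> C \<in> compacts_in UNIV
      then Inf {r. r > 0 \<and> B \<subseteq> thicken C r \<and> C \<subseteq> thicken B r}
      else 0)"

definition hausdorff_metric :: "'a::metric_space set metric" where
  "hausdorff_metric = metric (compacts_in UNIV, hausdorff_dist)"

lemma compacts_in_UNIV [simp]: "B \<in> compacts_in UNIV \<longleftrightarrow> B \<noteq> {} \<and> compact B"
  by (auto simp: compacts_in_def)

lemma hausdorff_radii_nonempty:
  assumes "B \<in> compacts_in UNIV" "C \<in> compacts_in UNIV"
  shows "{r. r > 0 \<and> B \<subseteq> thicken C r \<and> C \<subseteq> thicken B r} \<noteq> {}"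
proof -
  have "bounded (B \<union> C)"
    using assms by (simp add: compact_imp_bounded)
  then obtain e where e: "\<And>x y. x \<in> B \<union> C \<Longrightarrow> y \<in> B \<union> C \<Longrightarrow> dist x y \<le> e"
    unfolding bounded_two_points by blast
  obtain b c where "b \<in> B" "c \<in> C"
    using assms by auto
  have lt: "dist x y < \<bar>e\<bar> + 1" if "x \<in> B \<union> C" "y \<in> B \<union> C" for x y
    using e[OF that] by linarith
  have "B \<subseteq> thicken C (\<bar>e\<bar> + 1)" "C \<subseteq> thicken B (\<bar>e\<bar> + 1)"
    using lt \<open>b \<in> B\<close> \<open>c \<in> C\<close> by (auto simp: thicken_def)
  then have "\<bar>e\<bar> + 1 \<in> {r. r > 0 \<and> B \<subseteq> thicken C r \<and> C \<subseteq> thicken B r}"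
    by auto
  then show ?thesis by blast
qed

lemma thicken_mono: "r \<le> s \<Longrightarrow> thicken S r \<subseteq> thicken S s"
  by (force simp: thicken_def)

lemma thicken_thicken: "B \<subseteq> thicken C r \<Longrightarrow> C \<subseteq> thicken D s \<Longrightarrow> B \<subseteq> thicken D (s + r)"
proof
  fix x assume BC: "B \<subseteq> thicken C r" and CD: "C \<subseteq> thicken D s" and "x \<in> B"
  then obtain y where "y \<in> C" "dist y x < r"
    by (auto simp: thicken_def)
  moreover obtain z where "z \<in> D" "dist z y < s"
    using CD \<open>y \<in> C\<close> by (auto simp: thicken_def)
  moreover have "dist z x \<le> dist z y + dist y x"
    by (rule dist_triangle)
  ultimately show "x \<in> thicken D (s + r)"
    unfolding thicken_def by force
qed

lemma hausdorff_dist_less_iff: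
  assumes "B \<in> compacts_in UNIV" "C \<in> compacts_in UNIV"
  shows "hausdorff_dist B C < e \<longleftrightarrow> (\<exists>r. 0 < r \<and> r < e \<and> B \<subseteq> thicken C r \<and> C \<subseteq> thicken B r)"
proof -
  have "bdd_below {r. r > 0 \<and> B \<subseteq> thicken C r \<and> C \<subseteq> thicken B r}"
    by (rule bdd_belowI[of _ 0]) auto
  then show ?thesis
    using assms by (auto simp: hausdorff_dist_def cInf_less_iff[OF hausdorff_radii_nonempty[OF assms]])
qed

lemma hausdorff_dist_nonneg: "hausdorff_dist B C \<ge> 0"
proof (cases "B \<in> compacts_in UNIV \<and> C \<in> compacts_in UNIV")
  case True
  then show ?thesis
    using hausdorff_dist_less_iff[of B C 0] by force
next
  case False
  then show ?thesis by (auto simp: hausdorff_dist_def)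
qed

lemma closed_subset_thicken:
  assumes "closed C" and le: "\<And>e. e > 0 \<Longrightarrow> B \<subseteq> thicken C e"
  shows "B \<subseteq> C"
proof
  fix x assume "x \<in> B"
  have "\<exists>y\<in>C. dist y x < e" if "e > 0" for e
    using le[OF that] \<open>x \<in> B\<close> by (auto simp: thicken_def)
  then have "x \<in> closure C"
    by (simp add: closure_approachable)
  then show "x \<in> C" using \<open>closed C\<close> by simp
qed

lemma Metric_space_hausdorff: "Metric_space (compacts_in UNIV) hausdorff_dist"
proof
  show "0 \<le> hausdorff_dist B C" for B C :: "'a set"
    by (rule hausdorff_dist_nonneg)
  show "hausdorff_dist B C = hausdorff_dist C B" for B C :: "'a set"
    by (simp add: hausdorff_dist_def conj_commute)
  fix B C :: "'a set"
  assume B: "B \<in> compacts_in UNIV" and C: "C \<in> compacts_in UNIV"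
  show "hausdorff_dist B C = 0 \<longleftrightarrow> B = C"
  proof
    assume 0: "hausdorff_dist B C = 0"
    have *: "B \<subseteq> thicken C e" "C \<subseteq> thicken B e" if e: "e > 0" for e
    proof -
      obtain r where "r < e" "B \<subseteq> thicken C r" "C \<subseteq> thicken B r"
        using hausdorff_dist_less_iff[OF B C, of e] 0 e by auto
      then show "B \<subseteq> thicken C e" "C \<subseteq> thicken B e"
        using thicken_mono[of r e] by fastforce+
    qed
    show "B = C"
      using closed_subset_thicken * B C by (metis compacts_in_UNIV compact_imp_closed subset_antisym)
  next
    assume "B = C"
    have "hausdorff_dist B C < e" if "e > 0" for e
      unfolding hausdorff_dist_less_iff[OF B C] using that \<open>B = C\<close>
      by (intro exI[of _ "e/2"]) (force simp: thicken_def)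
    then show "hausdorff_dist B C = 0"
      using hausdorff_dist_nonneg[of B C] by (metis less_irrefl order_le_less)
  qed
  fix D :: "'a set"
  assume D: "D \<in> compacts_in UNIV"
  show "hausdorff_dist B D \<le> hausdorff_dist B C + hausdorff_dist C D"
  proof (rule field_le_epsilon)
    fix e :: real assume "e > 0"
    obtain r where r: "0 < r" "r < hausdorff_dist B C + e/2" "B \<subseteq> thicken C r" "C \<subseteq> thicken B r"
      using hausdorff_dist_less_iff[OF B C, of "hausdorff_dist B C + e/2"] \<open>e > 0\<close> by auto
    obtain s where s: "0 < s" "s < hausdorff_dist C D + e/2" "C \<subseteq> thicken D s" "D \<subseteq> thicken C s"
      using hausdorff_dist_less_iff[OF C D, of "hausdorff_dist C D + e/2"] \<open>e > 0\<close> by auto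
    have "B \<subseteq> thicken D (r + s)" "D \<subseteq> thicken B (r + s)"
      using thicken_thicken[OF r(3) s(3)] thicken_thicken[OF s(4) r(4)] by (simp_all add: add.commute)
    then have "hausdorff_dist B D < hausdorff_dist B C + hausdorff_dist C D + e"
      unfolding hausdorff_dist_less_iff[OF B D] using r s
      by (intro exI[of _ "r + s"]) auto
    then show "hausdorff_dist B D \<le> hausdorff_dist B C + hausdorff_dist C D + e"
      by simp
  qed
qed

lemma mspace_hausdorff_metric [simp]: "mspace hausdorff_metric = compacts_in UNIV"
  and mdist_hausdorff_metric [simp]: "mdist hausdorff_metric = hausdorff_dist"
  by (simp_all only: hausdorff_metric_def Metric_space.mspace_metric[OF Metric_space_hausdorff]
      Metric_space.mdist_metric[OF Metric_space_hausdorff])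

definition ifs :: "nat \<Rightarrow> (nat \<Rightarrow> 'a \<Rightarrow> 'a::metric_space) \<Rightarrow> bool" where
  "ifs M f \<longleftrightarrow> (\<forall>m\<in>{1..M}. continuous_on UNIV (f m))"

definition ifs_map :: "nat \<Rightarrow> (nat \<Rightarrow> 'a \<Rightarrow> 'a) \<Rightarrow> 'a set \<Rightarrow> 'a set" where
  "ifs_map M f B = (\<Union>m\<in>{1..M}. f m ` B)"

definition attracts_on ::
    "nat \<Rightarrow> (nat \<Rightarrow> 'a \<Rightarrow> 'a::metric_space) \<Rightarrow> 'a set \<Rightarrow> 'a set \<Rightarrow> bool" where
  "attracts_on M f A U \<longleftrightarrow>
     open U \<and> A \<subseteq> U \<and>
     (\<forall>B\<in>compacts_in U.
        limitin (mtopology_of hausdorff_metric) (\<lambda>k. (ifs_map M f ^^ k) B) A sequentially)"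

definition is_attractor ::
    "nat \<Rightarrow> (nat \<Rightarrow> 'a \<Rightarrow> 'a::metric_space) \<Rightarrow> 'a set \<Rightarrow> bool" where
  "is_attractor M f A \<longleftrightarrow>
     A \<noteq> {} \<and> compact A \<and> ifs_map M f A = A \<and> (\<exists>U. attracts_on M f A U)"

definition is_basin ::
    "nat \<Rightarrow> (nat \<Rightarrow> 'a \<Rightarrow> 'a::metric_space) \<Rightarrow> 'a set \<Rightarrow> 'a set \<Rightarrow> bool" where
  "is_basin M f A U \<longleftrightarrow> attracts_on M f A U \<and> (\<forall>V. attracts_on M f A V \<longrightarrow> V \<subseteq> U)"

end

theory Submission
  imports Defs
begin

text \<open>
  Hausdorff convergence of compact sets implies convergence in the sense of Kuratowski: if
  \<open>S k\<close> tends to \<open>A\<close>, then for each \<open>e > 0\<close> the tail \<open>\<Union>k\<ge>K. S k\<close> is, for large \<open>K\<close>, contained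
  in the \<open>e\<close>-neighbourhood of \<open>A\<close>, and conversely every point of \<open>A\<close> is within \<open>e\<close> of every
  tail. So \<open>A\<close> is the intersection of the closures of the tails.

  This applies to \<open>S k = F\<^sup>k (closure B)\<close>, because \<open>closure B\<close> is a compact subset of the basin.
  It remains to replace \<open>closure B\<close> by \<open>B\<close>, which need not be compact. A continuous map sends
  the closure of a set into the closure of its image, so \<open>F\<^sup>k B\<close> is dense in
  \<open>F\<^sup>k (closure B)\<close>. Closures of unions do not see the difference between a set and a dense
  subset of it. The lemma \<open>limit_eq_Inter_closure_tails\<close> is therefore stated directly for
  dense subsets \<open>D k\<close> of the sets \<open>S k\<close>.
\<close>

lemma limitin_hausdorff_iff:
  "limitin (mtopology_of hausdorff_metric) S A sequentially \<longleftrightarrow>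
     A \<in> compacts_in UNIV \<and>
     (\<forall>e>0. \<forall>\<^sub>F k in sequentially. S k \<in> compacts_in UNIV \<and> hausdorff_dist (S k) A < e)"
  by (simp only: mtopology_of_def mspace_hausdorff_metric mdist_hausdorff_metric
      Metric_space.limitin_metric[OF Metric_space_hausdorff])

lemma eventually_thicken_of_limit:
  assumes "limitin (mtopology_of hausdorff_metric) S A sequentially" and "e > 0"
  shows "\<forall>\<^sub>F k in sequentially. S k \<subseteq> thicken A e \<and> A \<subseteq> thicken (S k) e"
proof -
  have A: "A \<in> compacts_in UNIV"
    and ev: "\<forall>\<^sub>F k in sequentially. S k \<in> compacts_in UNIV \<and> hausdorff_dist (S k) A < e"
    using assms by (simp_all only: limitin_hausdorff_iff)
  show ?thesis
    using ev
  proof eventually_elim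
    case (elim k)
    then obtain r where "r < e" "S k \<subseteq> thicken A r" "A \<subseteq> thicken (S k) r"
      using hausdorff_dist_less_iff[of "S k" A e] A by blast
    then show ?case
      using thicken_mono[of r e] by (meson less_imp_le subset_trans)
  qed
qed

text \<open>Passing to the closure costs an arbitrarily small enlargement of the radius; doubling it
  is enough.\<close>

lemma closure_subset_thicken_double:
  assumes "S \<subseteq> thicken A e" and "e > 0"
  shows "closure S \<subseteq> thicken A (2 * e)"
proof -
  have "closure S \<subseteq> thicken S e"
    using \<open>e > 0\<close> by (auto simp: closure_approachable thicken_def)
  from thicken_thicken[OF this assms(1)] show ?thesis by simp
qed

text \<open>A Hausdorff limit is the topological upper limit of the sequence, and it can be
  computed from dense subsets of the terms.\<close>

lemma limit_eq_Inter_closure_tails: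
  fixes S D :: "nat \<Rightarrow> 'a::metric_space set"
  assumes lim: "limitin (mtopology_of hausdorff_metric) S A sequentially"
    and sub: "\<And>k. D k \<subseteq> S k" and dense: "\<And>k. S k \<subseteq> closure (D k)"
  shows "A = (\<Inter>K\<in>{K0..}. closure (\<Union>k\<in>{K..}. D k))"
proof
  show "A \<subseteq> (\<Inter>K\<in>{K0..}. closure (\<Union>k\<in>{K..}. D k))"
  proof (rule INT_greatest)
    fix K
    show "A \<subseteq> closure (\<Union>k\<in>{K..}. D k)"
    proof (rule closed_subset_thicken[OF closed_closure])
      fix e :: real assume "e > 0"
      have "\<forall>\<^sub>F k in sequentially. A \<subseteq> thicken (S k) e \<and> k \<ge> K"
        using eventually_thicken_of_limit[OF lim \<open>e > 0\<close>] eventually_ge_at_top[of K]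
        by eventually_elim blast
      then obtain k where k: "A \<subseteq> thicken (S k) e" "k \<ge> K"
        using eventually_happens'[OF sequentially_bot] by blast
      have "S k \<subseteq> closure (\<Union>k\<in>{K..}. D k)"
        using dense[of k] closure_mono[of "D k" "\<Union>k\<in>{K..}. D k"] k(2) by blast
      then show "A \<subseteq> thicken (closure (\<Union>k\<in>{K..}. D k)) e"
        using k(1) unfolding thicken_def by blast
    qed
  qed
next
  have "closed A"
    using lim by (simp add: limitin_hausdorff_iff compact_imp_closed)
  then show "(\<Inter>K\<in>{K0..}. closure (\<Union>k\<in>{K..}. D k)) \<subseteq> A"
  proof (rule closed_subset_thicken)
    fix e :: real assume "e > 0"
    then have half: "e / 2 > 0" by simp
    then obtain N where N: "\<And>k. k \<ge> N \<Longrightarrow> S k \<subseteq> thicken A (e / 2)"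
      using eventually_thicken_of_limit[OF lim half] unfolding eventually_sequentially by blast
    \<comment> \<open>Only tails from \<open>K0\<close> on occur in the intersection, so \<open>N\<close> itself may be too small.\<close>
    define K where "K = max K0 N"
    have "(\<Union>k\<in>{K..}. D k) \<subseteq> thicken A (e / 2)"
      using sub N unfolding K_def by fastforce
    then have "closure (\<Union>k\<in>{K..}. D k) \<subseteq> thicken A e"
      using closure_subset_thicken_double[OF _ half] by simp
    moreover have "K \<in> {K0..}" by (simp add: K_def)
    ultimately show "(\<Inter>K\<in>{K0..}. closure (\<Union>k\<in>{K..}. D k)) \<subseteq> thicken A e"
      by blast
  qed
qed

lemma ifs_map_mono: "B \<subseteq> C \<Longrightarrow> ifs_map M f B \<subseteq> ifs_map M f C"
  by (auto simp: ifs_map_def)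

lemma ifs_map_iterate_mono: "B \<subseteq> C \<Longrightarrow> (ifs_map M f ^^ k) B \<subseteq> (ifs_map M f ^^ k) C"
  by (induction k) (simp_all add: ifs_map_mono)

lemma ifs_map_closure_subset:
  assumes "ifs M f"
  shows "ifs_map M f (closure B) \<subseteq> closure (ifs_map M f B)"
  unfolding ifs_map_def
proof (rule UN_least)
  fix m assume m: "m \<in> {1..M}"
  then have "continuous_on (closure B) (f m)"
    using assms continuous_on_subset unfolding ifs_def by blast
  moreover have "f m ` B \<subseteq> closure (\<Union>m\<in>{1..M}. f m ` B)"
    using m closure_subset[of "\<Union>m\<in>{1..M}. f m ` B"] by blast
  ultimately show "f m ` closure B \<subseteq> closure (\<Union>m\<in>{1..M}. f m ` B)"
    by (intro image_closure_subset closed_closure)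
qed

lemma ifs_map_iterate_closure_subset:
  assumes "ifs M f"
  shows "(ifs_map M f ^^ k) (closure B) \<subseteq> closure ((ifs_map M f ^^ k) B)"
proof (induction k)
  case (Suc k)
  then have "ifs_map M f ((ifs_map M f ^^ k) (closure B))
      \<subseteq> ifs_map M f (closure ((ifs_map M f ^^ k) B))"
    by (rule ifs_map_mono)
  also have "\<dots> \<subseteq> closure (ifs_map M f ((ifs_map M f ^^ k) B))"
    by (rule ifs_map_closure_subset[OF assms])
  finally show ?case by simp
qed simp

theorem theorem2:
  fixes M :: nat
    and f :: "nat \<Rightarrow> 'a \<Rightarrow> 'a::complete_space"
    and A U :: "'a set"
  assumes "ifs M f"
    and "is_attractor M f A"
    and "is_basin M f A U"
    and "continuous_map
           (subtopology (mtopology_of hausdorff_metric) (compacts_in U))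
           (subtopology (mtopology_of hausdorff_metric) (compacts_in U))
           (ifs_map M f)"
  shows "\<forall>B. B \<subseteq> U \<and> closure B \<in> compacts_in U \<longrightarrow>
           A = (\<Inter>K\<in>{1..}. closure (\<Union>k\<in>{K..}. (ifs_map M f ^^ k) B))"
proof (intro allI impI)
  fix B assume B: "B \<subseteq> U \<and> closure B \<in> compacts_in U"
  then have "limitin (mtopology_of hausdorff_metric)
      (\<lambda>k. (ifs_map M f ^^ k) (closure B)) A sequentially"
    using assms(3) unfolding is_basin_def attracts_on_def by blast
  then show "A = (\<Inter>K\<in>{1..}. closure (\<Union>k\<in>{K..}. (ifs_map M f ^^ k) B))"
    by (rule limit_eq_Inter_closure_tails)
      (intro ifs_map_iterate_mono closure_subset ifs_map_iterate_closure_subset[OF assms(1)])+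
qed

end
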